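(* Let $A$ be an Archimedean semiprime $f$-algebra and $B$ a relatively uniformly complete Archimedean semiprime $f$-algebra. Then any order bounded algebra homomorphism $T:A\to B$ is a lattice homomorphism.
   Context: All spaces are real. A Riesz algebra is a Riesz space with an associative algebra multiplication such that products of positive elements are positive. It is an $f$-algebra if $a\wedge b=0$ implies $ac\wedge b=ca\wedge b=0$ for all $c\ge 0$. An $f$-algebra is semiprime if $0$ is its only nilpotent element. A Riesz space is relatively uniformly complete if every relatively uniformly Cauchy sequence converges relatively uniformly. Algebra homomorphisms are linear and multiplicative; an operator is order bounded if it maps order intervals into order bounded sets. *)

theory Defs
  imports Complex_Main "HOL-Library.Lattice_Algebras"
begin

class riesz_space = ordered_real_vector + lattice_ab_group_add_abs

class archimedean_riesz_space = riesz_space +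
  assumes archimedean: "0 \<le> x \<Longrightarrow> (\<And>n::nat. real n *\<^sub>R x \<le> y) \<Longrightarrow> x = 0"

definition (in riesz_space) rel_uniform_Cauchy_wrt :: "'a \<Rightarrow> (nat \<Rightarrow> 'a) \<Rightarrow> bool" where
  "rel_uniform_Cauchy_wrt u X \<longleftrightarrow>
     (\<forall>\<epsilon>::real. 0 < \<epsilon> \<longrightarrow> (\<exists>N. \<forall>m\<ge>N. \<forall>n\<ge>N. \<bar>X m - X n\<bar> \<le> \<epsilon> *\<^sub>R u))"

definition (in riesz_space) rel_uniform_Cauchy :: "(nat \<Rightarrow> 'a) \<Rightarrow> bool" where
  "rel_uniform_Cauchy X \<longleftrightarrow> (\<exists>u\<ge>0. rel_uniform_Cauchy_wrt u X)"

definition (in riesz_space) rel_uniform_limit_wrt :: "'a \<Rightarrow> (nat \<Rightarrow> 'a) \<Rightarrow> 'a \<Rightarrow> bool" where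
  "rel_uniform_limit_wrt u X l \<longleftrightarrow>
     (\<forall>\<epsilon>::real. 0 < \<epsilon> \<longrightarrow> (\<exists>N. \<forall>n\<ge>N. \<bar>X n - l\<bar> \<le> \<epsilon> *\<^sub>R u))"

definition (in riesz_space) rel_uniform_convergent :: "(nat \<Rightarrow> 'a) \<Rightarrow> bool" where
  "rel_uniform_convergent X \<longleftrightarrow> (\<exists>l. \<exists>u\<ge>0. rel_uniform_limit_wrt u X l)"

class rel_uniform_complete_riesz_space = riesz_space +
  assumes rel_uniform_complete: "rel_uniform_Cauchy X \<Longrightarrow> rel_uniform_convergent X"

text \<open>The monotonicity axioms of \<^class>\<open>lattice_ring\<close> amount to closure of the positive cone under
  multiplication. Neither commutativity nor a unit is assumed.\<close>

class riesz_algebra = riesz_space + real_algebra + lattice_ring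

class f_algebra = riesz_algebra +
  assumes inf_mult_right_eq_0: "inf a b = 0 \<Longrightarrow> 0 \<le> c \<Longrightarrow> inf (a * c) b = 0"
    and inf_mult_left_eq_0: "inf a b = 0 \<Longrightarrow> 0 \<le> c \<Longrightarrow> inf (c * a) b = 0"

text \<open>In the absence of a unit, the power of exponent \<open>n + 1\<close> is expressed by iterated multiplication.\<close>

definition (in ring) nilpotent :: "'a \<Rightarrow> bool" where
  "nilpotent x \<longleftrightarrow> (\<exists>n. ((*) x ^^ n) x = 0)"

class semiprime_f_algebra = f_algebra +
  assumes semiprime: "nilpotent x \<Longrightarrow> x = 0"

definition algebra_homomorphism :: "('a::real_algebra \<Rightarrow> 'b::real_algebra) \<Rightarrow> bool" where
  "algebra_homomorphism T \<longleftrightarrow> linear T \<and> (\<forall>x y. T (x * y) = T x * T y)"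

definition order_bounded :: "('a::riesz_space \<Rightarrow> 'b::riesz_space) \<Rightarrow> bool" where
  "order_bounded T \<longleftrightarrow> (\<forall>a b. \<exists>c d. T ` {a..b} \<subseteq> {c..d})"

definition lattice_homomorphism :: "('a::riesz_space \<Rightarrow> 'b::riesz_space) \<Rightarrow> bool" where
  "lattice_homomorphism T \<longleftrightarrow>
     linear T \<and> (\<forall>x y. T (sup x y) = sup (T x) (T y)) \<and> (\<forall>x y. T (inf x y) = inf (T x) (T y))"

end

theory Submission
  imports Defs
begin

text \<open>
  In a semiprime \<open>f\<close>-algebra two elements have product zero exactly when they are disjoint, so an
  algebra homomorphism preserves disjointness. For an order bounded operator \<open>T\<close> with this property
  the signs are rigid (\<open>disjointness_preserving_sign\<close>, a form of Meyer's theorem): for positive \<open>a\<close>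
  and \<open>b\<close> the negative part of \<open>T a\<close> is disjoint from the positive part of \<open>T b\<close>. Taking
  \<open>b = a * a\<close>, where \<open>T b = T a * T a\<close> is positive, makes the negative part \<open>p\<close> of \<open>T a\<close> disjoint
  from \<open>(T a)\<^sup>2\<close>, hence from \<open>p\<^sup>2\<close>; this forces \<open>p\<^sup>2 = 0\<close> and, by semiprimeness, \<open>p = 0\<close>. Thus \<open>T\<close> is
  positive, and a positive operator that preserves disjointness is a lattice homomorphism.

  The rigidity of signs is best seen at a single point of a function space. There, for each
  \<open>\<lambda> \<ge> 0\<close>, one of \<open>T ((a - \<lambda> b)\<^sup>+)\<close> and \<open>T ((\<lambda> b - a)\<^sup>+)\<close> vanishes. At \<open>\<lambda> = 0\<close> it is the second,
  and if \<open>T b \<noteq> 0\<close>, then for large \<open>\<lambda>\<close> it is the first, because \<open>T\<close> is bounded on the interval from \<open>0\<close> to \<open>a\<close>.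
  Between two close values of \<open>\<lambda>\<close> the vanishing term switches, and by order boundedness
  \<open>T a - \<lambda> T b\<close> is small there. If \<open>T a < 0 < T b\<close>, its modulus is at least that of \<open>T a\<close>: a
  contradiction. The proof carries this out without points, by an induction along a grid of values
  of \<open>\<lambda>\<close>, and lets the mesh tend to zero by the Archimedean property.
\<close>

section \<open>Disjointness in Riesz spaces\<close>

lemma pprt_diff_pprt_uminus:
  fixes x :: "'a::riesz_space"
  shows "pprt x - pprt (- x) = x"
  using prts[of x] by (simp add: pprt_neg)

lemma pprt_diff_eq:
  fixes x y :: "'a::riesz_space"
  shows "pprt (x - y) = x - inf x y"
proof -
  have "x - inf x y = x + sup (- x) (- y)"
    by (simp only: inf_eq_neg_sup diff_minus_eq_add)
  also have "\<dots> = sup (x + - x) (x + - y)"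
    by (rule add_sup_distrib_left)
  also have "\<dots> = pprt (x - y)"
    by (simp add: pprt_def sup.commute)
  finally show ?thesis ..
qed

lemma inf_pprt_pprt_uminus:
  fixes x :: "'a::riesz_space"
  shows "inf (pprt x) (pprt (- x)) = 0"
  using pprt_diff_eq[of "pprt x" "pprt (- x)"]
  by (simp only: pprt_diff_pprt_uminus) (metis diff_0_right diff_left_imp_eq)

lemma pprt_add_le:
  fixes x y :: "'a::riesz_space"
  assumes "0 \<le> y"
  shows "pprt (x + y) \<le> pprt x + y"
  using assms by (auto simp: pprt_def add_increasing intro: add_right_mono)

lemma disjoint_mono:
  fixes v w x y :: "'a::riesz_space"
  assumes "inf w y = 0" "0 \<le> v" "v \<le> w" "0 \<le> x" "x \<le> y"
  shows "inf v x = 0"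
  using assms by (metis inf_mono le_infI order_antisym)

lemma le_of_le_add_disjoint:
  fixes v x y :: "'a::riesz_space"
  assumes "v \<le> x + y" "inf v y = 0" "0 \<le> x"
  shows "v \<le> x"
proof -
  have "v - x \<le> inf v y"
    using assms(1,3) by (simp add: diff_le_eq add.commute)
  then show ?thesis
    using assms by simp
qed

lemma disjoint_scaleR:
  fixes v x :: "'a::riesz_space" and r :: real
  assumes "inf v x = 0" "0 \<le> r"
  shows "inf v (r *\<^sub>R x) = 0"
proof -
  have v: "0 \<le> v" and x: "0 \<le> x"
    using assms(1) by (metis inf_le1, metis inf_le2)
  define s where "s = max 1 r"
  have s: "0 < s" "1 \<le> s" "r \<le> s" by (auto simp: s_def)
  define z where "z = inf v (r *\<^sub>R x)"
  have "z \<le> s *\<^sub>R v"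
    using scaleR_right_mono[OF s(2) v] by (auto simp: z_def intro: le_infI1)
  moreover have "z \<le> s *\<^sub>R x"
    using scaleR_right_mono[OF s(3) x] by (auto simp: z_def intro: le_infI2)
  ultimately have "(1 / s) *\<^sub>R z \<le> v" "(1 / s) *\<^sub>R z \<le> x"
    using s scaleR_left_mono[of z _ "1 / s"] by force+
  then have "(1 / s) *\<^sub>R z \<le> 0"
    using assms(1) by (metis le_inf_iff)
  then have "s *\<^sub>R (1 / s) *\<^sub>R z \<le> s *\<^sub>R 0"
    using s by (intro scaleR_left_mono) auto
  then have "z \<le> 0"
    using s by simp
  moreover have "0 \<le> z"
    using v x assms(2) by (simp add: z_def scaleR_nonneg_nonneg)
  ultimately show ?thesis
    unfolding z_def by (rule order_antisym)
qed

section \<open>Order bounded operators that preserve disjointness\<close>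

lemma order_bounded_obtain_bound:
  fixes T :: "'a::riesz_space \<Rightarrow> 'b::riesz_space"
  assumes "order_bounded T"
  obtains C where "0 \<le> C" "\<And>z. 0 \<le> z \<Longrightarrow> z \<le> u \<Longrightarrow> \<bar>T z\<bar> \<le> C"
proof -
  obtain c d where cd: "T ` {0..u} \<subseteq> {c..d}"
    using assms unfolding order_bounded_def by blast
  show thesis
  proof
    show "0 \<le> \<bar>c\<bar> + \<bar>d\<bar>"
      by simp
    fix z :: 'a
    assume "0 \<le> z" "z \<le> u"
    then have "c \<le> T z" "T z \<le> d"
      using cd by (auto simp: image_subset_iff)
    moreover have "d \<le> \<bar>c\<bar> + \<bar>d\<bar>"
      by (intro add_increasing abs_ge_self abs_ge_zero)
    moreover have "- c \<le> \<bar>c\<bar> + \<bar>d\<bar>"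
      by (intro add_increasing2 abs_ge_minus_self abs_ge_zero)
    ultimately show "\<bar>T z\<bar> \<le> \<bar>c\<bar> + \<bar>d\<bar>"
      by (meson abs_leI neg_le_iff_le order_trans)
  qed
qed

definition disjointness_preserving :: "('a::riesz_space \<Rightarrow> 'b::riesz_space) \<Rightarrow> bool" where
  "disjointness_preserving T \<longleftrightarrow> (\<forall>x y. inf x y = 0 \<longrightarrow> inf \<bar>T x\<bar> \<bar>T y\<bar> = 0)"

text \<open>
  The quantitative step. The excess \<open>w\<close> of the meet over \<open>1 / n\<close> times the bound \<open>C\<close> is shown
  to be disjoint from each \<open>Q k = T ((k/n b - a)\<^sup>+)\<close>: at a point where \<open>Q k\<close> and
  \<open>P (k + 1) = T ((a - (k+1)/n b)\<^sup>+)\<close> both vanish, \<open>T a - k/n T b\<close> has modulus at most \<open>C / n\<close>, whereas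
  opposite signs of \<open>T a\<close> and \<open>T b\<close> make its modulus at least that of \<open>T a\<close>. The grid
  ends at \<open>k/n = n\<close>, where \<open>w\<close> is dominated by a multiple of \<open>\<bar>Q k\<bar>\<close>.
\<close>

lemma disjointness_preserving_sign_bound:
  fixes T :: "'a::riesz_space \<Rightarrow> 'b::riesz_space" and n :: nat
  assumes lin: "linear T" and disj: "disjointness_preserving T"
    and a: "0 \<le> a" and b: "0 \<le> b" and n: "0 < n" and C: "0 \<le> C"
    and boundA: "\<And>z. 0 \<le> z \<Longrightarrow> z \<le> a \<Longrightarrow> \<bar>T z\<bar> \<le> C"
    and boundB: "\<And>z. 0 \<le> z \<Longrightarrow> z \<le> b \<Longrightarrow> \<bar>T z\<bar> \<le> C"
  shows "inf (pprt (- T a)) (pprt (T b)) \<le> (1 / real n) *\<^sub>R C"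
proof -
  define l where "l k = real k / real n" for k :: nat
  define P where "P k = T (pprt (a - l k *\<^sub>R b))" for k
  define Q where "Q k = T (pprt (l k *\<^sub>R b - a))" for k
  define e where "e = (1 / real n) *\<^sub>R C"
  define w0 where "w0 = inf (pprt (- T a)) (pprt (T b))"
  define w where "w = pprt (w0 - e)"
  have l0: "0 \<le> l k" for k by (simp add: l_def)
  have e0: "0 \<le> e" using C by (simp add: e_def scaleR_nonneg_nonneg)
  have w0_nonneg: "0 \<le> w0" by (simp add: w0_def)
  have w_nonneg: "0 \<le> w" by (simp add: w_def)
  have w_le: "w \<le> z" if "w0 \<le> z + e" "0 \<le> z" for z
    using that by (simp add: w_def pprt_def diff_le_eq)
  have w_le_w0: "w \<le> w0"
    by (rule w_le) (use e0 w0_nonneg in auto)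
  have T_nonneg_diff: "\<bar>T z\<bar> \<le> e" if "0 \<le> z" "z \<le> (1 / real n) *\<^sub>R b" for z
  proof -
    have "real n *\<^sub>R z \<le> real n *\<^sub>R (1 / real n) *\<^sub>R b"
      using that by (intro scaleR_left_mono) auto
    then have "\<bar>T (real n *\<^sub>R z)\<bar> \<le> C"
      using n that by (intro boundB) (auto simp: scaleR_nonneg_nonneg)
    then have "real n *\<^sub>R T z \<le> C" "real n *\<^sub>R (- T z) \<le> C"
      using lin by (auto simp: linear_scale intro: order_trans[OF abs_ge_self]
          order_trans[OF abs_ge_minus_self])
    then have "(1 / real n) *\<^sub>R real n *\<^sub>R T z \<le> e" "(1 / real n) *\<^sub>R real n *\<^sub>R (- T z) \<le> e"
      unfolding e_def by (auto intro!: scaleR_left_mono simp del: scaleR_scaleR scaleR_minus_right)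
    then show ?thesis
      using n by (intro abs_leI) auto
  qed
  have PQ: "P k - Q k = T a - l k *\<^sub>R T b" for k
  proof -
    have "P k - Q k = T (pprt (a - l k *\<^sub>R b) - pprt (- (a - l k *\<^sub>R b)))"
      using lin by (simp add: P_def Q_def linear_diff)
    then show ?thesis
      using lin by (simp only: pprt_diff_pprt_uminus) (simp add: linear_diff linear_scale)
  qed
  have disjPQ: "inf \<bar>Q k\<bar> \<bar>P k\<bar> = 0" for k
  proof -
    have "inf (pprt (l k *\<^sub>R b - a)) (pprt (a - l k *\<^sub>R b)) = 0"
      using inf_pprt_pprt_uminus[of "l k *\<^sub>R b - a"] by simp
    then show ?thesis
      using disj by (simp add: disjointness_preserving_def P_def Q_def)
  qed
  have P_step: "- P k \<le> \<bar>P (Suc k)\<bar> + e" for k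
  proof -
    define x where "x = a - l (Suc k) *\<^sub>R b"
    define y where "y = (1 / real n) *\<^sub>R b"
    have y: "0 \<le> y" using b by (simp add: y_def scaleR_nonneg_nonneg)
    have xy: "a - l k *\<^sub>R b = x + y"
      by (simp add: x_def y_def l_def add_divide_distrib scaleR_add_left)
    have "pprt x \<le> pprt (x + y)"
      using y by (intro pprt_mono) simp
    then have "\<bar>T (pprt (x + y) - pprt x)\<bar> \<le> e"
      using pprt_add_le[OF y, of x]
      by (intro T_nonneg_diff) (auto simp: y_def diff_le_eq add.commute)
    moreover have "T (pprt (x + y) - pprt x) = P k - P (Suc k)"
      using lin by (simp add: P_def xy linear_diff) (simp add: x_def)
    ultimately have "\<bar>P k - P (Suc k)\<bar> \<le> e" by simp
    then have "- (P k - P (Suc k)) \<le> e"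
      using abs_ge_minus_self order_trans by blast
    then have "- P k \<le> e - P (Suc k)"
      by (simp add: algebra_simps)
    also have "\<dots> \<le> \<bar>P (Suc k)\<bar> + e"
      using add_left_mono[OF abs_ge_minus_self[of "P (Suc k)"], of e] by (simp add: add.commute)
    finally show ?thesis .
  qed
  have w_disj: "inf w \<bar>Q k\<bar> = 0" for k
  proof (induction k)
    case 0
    have "Q 0 = 0"
      using a lin by (simp add: Q_def l_def linear_0)
    then show ?case
      using w_nonneg by (simp add: inf_absorb2)
  next
    case (Suc k)
    define v where "v = inf w \<bar>Q (Suc k)\<bar>"
    have v: "0 \<le> v" "v \<le> w" "v \<le> \<bar>Q (Suc k)\<bar>" "v \<le> w0"
      using w_nonneg w_le_w0 by (auto simp: v_def intro: le_infI1)
    \<comment> \<open>The last two summands correct for the parts of \<open>T a\<close> and \<open>T b\<close> with the wrong sign; the element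
      \<open>w0\<close>, and so \<open>v\<close>, is disjoint from both.\<close>
    define r where "r = \<bar>P (Suc k)\<bar> + pprt (T a) + l k *\<^sub>R pprt (- T b)"
    have "w0 \<le> pprt (- T a) + l k *\<^sub>R pprt (T b)"
      using l0[of k] by (intro add_increasing2) (auto simp: w0_def scaleR_nonneg_nonneg)
    also have "\<dots> = - (P k - Q k) + pprt (T a) + l k *\<^sub>R pprt (- T b)"
    proof -
      have "pprt (- T a) = pprt (T a) - T a" "pprt (T b) = T b + pprt (- T b)"
        using pprt_diff_pprt_uminus[of "T a"] pprt_diff_pprt_uminus[of "T b"]
        by (metis add_diff_cancel_left' diff_add_cancel, metis diff_add_cancel add.commute)
      then show ?thesis
        by (simp add: PQ scaleR_add_right)
    qed
    also have "\<dots> \<le> \<bar>Q k\<bar> + (\<bar>P (Suc k)\<bar> + e) + pprt (T a) + l k *\<^sub>R pprt (- T b)"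
      using add_mono[OF abs_ge_self[of "Q k"] P_step[of k]]
      by (intro add_right_mono) simp
    finally have "w \<le> \<bar>Q k\<bar> + r"
      using l0[of k]
      by (intro w_le) (auto simp: r_def algebra_simps scaleR_nonneg_nonneg intro!: add_nonneg_nonneg)
    with v(2) have le: "v \<le> 0 + l k *\<^sub>R pprt (- T b) + pprt (T a) + \<bar>P (Suc k)\<bar> + \<bar>Q k\<bar>"
      by (simp add: r_def algebra_simps)
    have d1: "inf v \<bar>Q k\<bar> = 0"
      using disjoint_mono[OF Suc.IH] v by simp
    have d2: "inf v \<bar>P (Suc k)\<bar> = 0"
      using disjoint_mono[OF disjPQ] v by simp
    have d3: "inf v (pprt (T a)) = 0"
    proof (rule disjoint_mono)
      show "inf (pprt (- T a)) (pprt (T a)) = 0"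
        using inf_pprt_pprt_uminus[of "- T a"] by simp
    qed (use v in \<open>auto simp: w0_def\<close>)
    have d4: "inf v (pprt (- T b)) = 0"
      by (rule disjoint_mono[OF inf_pprt_pprt_uminus[of "T b"]])
        (use v in \<open>auto simp: w0_def\<close>)
    have nn: "0 \<le> l k *\<^sub>R pprt (- T b)"
      using l0 by (simp add: scaleR_nonneg_nonneg)
    \<comment> \<open>All summands of the bound on \<open>v\<close> are disjoint from \<open>v\<close> and drop out one at a time.\<close>
    have "v \<le> 0 + l k *\<^sub>R pprt (- T b) + pprt (T a) + \<bar>P (Suc k)\<bar>"
      using le d1 by (rule le_of_le_add_disjoint) (use nn in \<open>auto intro!: add_nonneg_nonneg\<close>)
    then have "v \<le> 0 + l k *\<^sub>R pprt (- T b) + pprt (T a)"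
      using d2 by (rule le_of_le_add_disjoint) (use nn in \<open>auto intro!: add_nonneg_nonneg\<close>)
    then have "v \<le> 0 + l k *\<^sub>R pprt (- T b)"
      using d3 by (rule le_of_le_add_disjoint) (use nn in auto)
    then have "v \<le> 0"
      using disjoint_scaleR[OF d4 l0] by (rule le_of_le_add_disjoint) simp
    then have "v = 0"
      using v(1) by (rule order_antisym)
    then show ?case
      by (simp add: v_def)
  qed
  \<comment> \<open>The index \<open>n * n\<close> is where the grid of mesh \<open>1 / n\<close> reaches \<open>n\<close>; dividing the bound \<open>C\<close> on
    \<open>T (inf (n b) a)\<close> by \<open>n\<close> then gives \<open>e\<close> again.\<close>
  define q where "q = Q (n * n)"
  have ln: "l (n * n) = real n"
    using n by (simp add: l_def)
  have "w \<le> 0 + (1 / real n) *\<^sub>R \<bar>q\<bar>"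
  proof (rule w_le)
    have "q = T (real n *\<^sub>R b - inf (real n *\<^sub>R b) a)"
      by (simp add: q_def Q_def ln pprt_diff_eq)
    then have "q = real n *\<^sub>R T b - T (inf (real n *\<^sub>R b) a)"
      using lin by (simp only: linear_diff linear_scale)
    then have "real n *\<^sub>R T b = q + T (inf (real n *\<^sub>R b) a)"
      by (simp only: diff_add_cancel)
    also have "\<dots> \<le> \<bar>q\<bar> + C"
    proof (rule add_mono[OF abs_ge_self])
      have "\<bar>T (inf (real n *\<^sub>R b) a)\<bar> \<le> C"
        using a b by (intro boundA) (auto simp: scaleR_nonneg_nonneg)
      then show "T (inf (real n *\<^sub>R b) a) \<le> C"
        by (rule order_trans[OF abs_ge_self])
    qed
    finally have "(1 / real n) *\<^sub>R real n *\<^sub>R T b \<le> (1 / real n) *\<^sub>R (\<bar>q\<bar> + C)"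
      by (intro scaleR_left_mono) auto
    then have "T b \<le> (1 / real n) *\<^sub>R \<bar>q\<bar> + e"
      using n by (simp add: e_def scaleR_add_right)
    moreover have "0 \<le> (1 / real n) *\<^sub>R \<bar>q\<bar> + e"
      using e0 by (intro add_nonneg_nonneg) (auto simp: scaleR_nonneg_nonneg)
    ultimately have "pprt (T b) \<le> (1 / real n) *\<^sub>R \<bar>q\<bar> + e"
      by (simp add: pprt_def)
    then show "w0 \<le> 0 + (1 / real n) *\<^sub>R \<bar>q\<bar> + e"
      by (auto simp: w0_def intro: le_infI2)
  qed (auto simp: scaleR_nonneg_nonneg)
  then have "w \<le> 0"
  proof (rule le_of_le_add_disjoint)
    show "inf w ((1 / real n) *\<^sub>R \<bar>q\<bar>) = 0"
      unfolding q_def by (rule disjoint_scaleR[OF w_disj]) simp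
  qed simp
  then have "w0 - e \<le> 0"
    by (simp add: w_def pprt_def)
  then show ?thesis
    by (simp add: w0_def e_def)
qed

text \<open>
  In Meyer's theorem the parts \<open>T\<^sup>+\<close> and \<open>T\<^sup>-\<close> of the operator exist and are lattice homomorphisms
  with disjoint ranges, and \<open>(T a)\<^sup>- = T\<^sup>- a\<close> and \<open>(T b)\<^sup>+ = T\<^sup>+ b\<close> for positive \<open>a\<close> and \<open>b\<close>. The
  disjointness is obtained here without these operators, by letting \<open>n\<close> tend to infinity in the
  preceding bound.
\<close>

lemma disjointness_preserving_sign:
  fixes T :: "'a::riesz_space \<Rightarrow> 'b::archimedean_riesz_space"
  assumes "linear T" "order_bounded T" "disjointness_preserving T" "0 \<le> a" "0 \<le> b"
  shows "inf (pprt (- T a)) (pprt (T b)) = 0"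
proof -
  let ?w = "inf (pprt (- T a)) (pprt (T b))"
  obtain C where C: "0 \<le> C" "\<And>z. 0 \<le> z \<Longrightarrow> z \<le> a + b \<Longrightarrow> \<bar>T z\<bar> \<le> C"
    using order_bounded_obtain_bound[OF assms(2)] by metis
  have "real n *\<^sub>R ?w \<le> C" for n
  proof (cases "n = 0")
    case False
    have "?w \<le> (1 / real n) *\<^sub>R C"
    proof (rule disjointness_preserving_sign_bound[where T = T and a = a and b = b])
      fix z :: 'a
      assume z: "0 \<le> z"
      show "\<bar>T z\<bar> \<le> C" if "z \<le> a"
        using that z assms by (intro C) (auto intro: add_increasing2)
      show "\<bar>T z\<bar> \<le> C" if "z \<le> b"
        using that z assms by (intro C) (auto intro: add_increasing)
    qed (use assms C False in auto)
    then have "real n *\<^sub>R ?w \<le> real n *\<^sub>R (1 / real n) *\<^sub>R C"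
      by (intro scaleR_left_mono) auto
    then show ?thesis
      using False by simp
  qed (use C in simp)
  then show ?thesis
    by (intro archimedean[of _ C]) auto
qed

lemma positive_disjointness_preserving_lattice_homomorphism:
  fixes T :: "'a::riesz_space \<Rightarrow> 'b::riesz_space"
  assumes lin: "linear T" and disj: "disjointness_preserving T"
    and pos: "\<And>x. 0 \<le> x \<Longrightarrow> 0 \<le> T x"
  shows "lattice_homomorphism T"
proof -
  have T_pprt: "T (pprt z) = pprt (T z)" for z
  proof -
    have "inf (T (pprt z)) (T (pprt (- z))) = 0"
      using disj inf_pprt_pprt_uminus[of z] pos
      by (metis abs_of_nonneg disjointness_preserving_def zero_le_pprt)
    then have "T (pprt z) = pprt (T (pprt z) - T (pprt (- z)))"
      by (simp add: pprt_diff_eq)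
    then show ?thesis
      using lin by (simp add: pprt_diff_pprt_uminus flip: linear_diff)
  qed
  have inf: "T (inf x y) = inf (T x) (T y)" for x y
  proof -
    have "T (inf x y) = T (x - pprt (x - y))"
      by (simp add: pprt_diff_eq)
    also have "\<dots> = T x - pprt (T x - T y)"
      using lin by (simp add: linear_diff T_pprt)
    finally show ?thesis
      by (simp add: pprt_diff_eq)
  qed
  have "T (sup x y) = sup (T x) (T y)" for x y
    unfolding sup_eq_neg_inf by (simp only: linear_neg[OF lin] inf)
  then show ?thesis
    using lin inf by (simp add: lattice_homomorphism_def)
qed

section \<open>Zero products in semiprime \<open>f\<close>-algebras\<close>

lemma disjoint_imp_mult_eq_0:
  fixes x y :: "'a::f_algebra"
  assumes "inf x y = 0"
  shows "x * y = 0"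
proof -
  have "0 \<le> x" "0 \<le> y"
    using assms by (metis inf_le1, metis inf_le2)
  then have "inf y (x * y) = 0"
    using inf_mult_right_eq_0[OF assms] by (simp add: inf_commute)
  then show ?thesis
    using inf_mult_left_eq_0[of y "x * y" x] \<open>0 \<le> x\<close> by simp
qed

lemma square_eq_0_imp_eq_0:
  fixes x :: "'a::semiprime_f_algebra"
  assumes "x * x = 0"
  shows "x = 0"
proof (rule semiprime)
  have "((*) x ^^ 1) x = 0"
    using assms by simp
  then show "nilpotent x"
    unfolding nilpotent_def by blast
qed

text \<open>
  When \<open>x\<close> and \<open>y\<close> are expanded into positive and negative parts, the terms of the product with
  positive sign are disjoint from those with negative sign, because multiplication by positive
  elements preserves disjointness. Their difference is zero, so both groups vanish.
\<close>

lemma mult_eq_0_imp_abs_mult_abs_eq_0: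
  fixes x y :: "'a::f_algebra"
  assumes "x * y = 0"
  shows "\<bar>x\<bar> * \<bar>y\<bar> = 0"
proof -
  define p q r s where defs: "p = pprt x" "q = pprt (- x)" "r = pprt y" "s = pprt (- y)"
  have nn: "0 \<le> p" "0 \<le> q" "0 \<le> r" "0 \<le> s"
    by (simp_all add: defs)
  have pq: "inf p q = 0" and rs: "inf r s = 0"
    by (simp_all add: defs inf_pprt_pprt_uminus)
  have left: "inf (c * t) (d * u) = 0" if "inf t u = 0" "0 \<le> c" "0 \<le> d" for c d t u :: 'a
    using inf_mult_left_eq_0[of t u c] inf_mult_left_eq_0[of u "c * t" d] that
    by (simp add: inf_commute)
  have right: "inf (t * c) (u * d) = 0" if "inf t u = 0" "0 \<le> c" "0 \<le> d" for c d t u :: 'a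
    using inf_mult_right_eq_0[of t u c] inf_mult_right_eq_0[of u "t * c" d] that
    by (simp add: inf_commute)
  define A B where AB: "A = p * r + q * s" "B = p * s + q * r"
  have xy: "x = p - q" "y = r - s"
    by (simp_all add: defs pprt_diff_pprt_uminus)
  have "A = B"
    using assms by (simp add: AB xy algebra_simps)
  have absxy: "\<bar>x\<bar> = p + q" "\<bar>y\<bar> = r + s"
    by (simp_all add: defs abs_prts pprt_neg)
  have "p * r \<le> 0 + p * s + q * r"
    using \<open>A = B\<close> nn by (metis AB add_0 add_increasing2 le_add_same_cancel1 mult_nonneg_nonneg order_refl)
  then have "p * r \<le> 0 + p * s"
    by (rule le_of_le_add_disjoint) (use nn right[OF pq] in auto)
  then have "p * r \<le> 0"
    by (rule le_of_le_add_disjoint) (use nn left[OF rs] in auto)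
  moreover have "q * s \<le> 0"
  proof -
    have "q * s \<le> 0 + p * s + q * r"
      using \<open>A = B\<close> nn by (metis AB add_0 add_increasing mult_nonneg_nonneg order_refl)
    then have "q * s \<le> 0 + p * s"
      by (rule le_of_le_add_disjoint) (use nn left[OF rs] in \<open>auto simp: inf_commute\<close>)
    then show ?thesis
      by (rule le_of_le_add_disjoint) (use nn right[OF pq] in \<open>auto simp: inf_commute\<close>)
  qed
  ultimately have "A \<le> 0"
    unfolding AB by (rule add_nonpos_nonpos)
  moreover have "0 \<le> A"
    using nn by (simp add: AB)
  ultimately have "A = 0"
    by (rule order_antisym)
  moreover have "\<bar>x\<bar> * \<bar>y\<bar> = A + B"
    by (simp add: AB absxy algebra_simps)
  ultimately show ?thesis
    using \<open>A = B\<close> by simp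
qed

lemma mult_eq_0_imp_disjoint:
  fixes x y :: "'a::semiprime_f_algebra"
  assumes "x * y = 0"
  shows "inf \<bar>x\<bar> \<bar>y\<bar> = 0"
proof -
  let ?z = "inf \<bar>x\<bar> \<bar>y\<bar>"
  have z: "0 \<le> ?z" by simp
  have "?z * ?z \<le> \<bar>x\<bar> * \<bar>y\<bar>"
    by (intro mult_mono) auto
  then have "?z * ?z = 0"
    using mult_eq_0_imp_abs_mult_abs_eq_0[OF assms] z by (simp add: order_antisym)
  then show ?thesis
    by (rule square_eq_0_imp_eq_0)
qed

section \<open>Order bounded algebra homomorphisms\<close>

lemma algebra_homomorphism_disjointness_preserving:
  fixes T :: "'a::f_algebra \<Rightarrow> 'b::semiprime_f_algebra"
  assumes "algebra_homomorphism T"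
  shows "disjointness_preserving T"
  unfolding disjointness_preserving_def
proof (intro allI impI)
  fix x y :: 'a
  assume "inf x y = 0"
  then have "T x * T y = T 0"
    using assms disjoint_imp_mult_eq_0 by (metis algebra_homomorphism_def)
  then show "inf \<bar>T x\<bar> \<bar>T y\<bar> = 0"
    using assms by (intro mult_eq_0_imp_disjoint) (simp add: algebra_homomorphism_def linear_0)
qed

text \<open>
  Squares in the codomain are positive, so the rigidity of signs for \<open>a\<close> and \<open>a * a\<close> confines
  the sign of \<open>T a\<close>.
\<close>

lemma order_bounded_algebra_homomorphism_nonneg:
  fixes T :: "'a::f_algebra \<Rightarrow> 'b::{archimedean_riesz_space, semiprime_f_algebra}"
  assumes hom: "algebra_homomorphism T" and bdd: "order_bounded T" and a: "0 \<le> a"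
  shows "0 \<le> T a"
proof -
  define p q where pq: "p = pprt (- T a)" "q = pprt (T a)"
  have nn: "0 \<le> p" "0 \<le> q"
    by (simp_all add: pq)
  have disj: "inf q p = 0"
    by (simp add: pq inf_pprt_pprt_uminus)
  then have zero: "q * p = 0" "p * q = 0"
    by (simp_all add: disjoint_imp_mult_eq_0 inf_commute)
  have Ta: "T a = q - p"
    by (simp add: pq pprt_diff_pprt_uminus)
  have "T (a * a) = T a * T a"
    using hom by (simp add: algebra_homomorphism_def)
  also have "\<dots> = q * q + p * p"
    using zero by (simp add: Ta algebra_simps)
  finally have Taa: "T (a * a) = q * q + p * p" .
  have "inf p (pprt (T (a * a))) = 0"
    unfolding pq using hom bdd a
    by (intro disjointness_preserving_sign algebra_homomorphism_disjointness_preserving)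
      (auto simp: algebra_homomorphism_def)
  then have "inf p (q * q + p * p) = 0"
    using nn by (simp add: Taa)
  then have "inf p (p * p) = 0"
    by (rule disjoint_mono) (use nn in auto)
  then have "p * p = 0"
    using inf_mult_right_eq_0[of p "p * p" p] nn by simp
  then have "p = 0"
    by (rule square_eq_0_imp_eq_0)
  then show ?thesis
    using nn by (simp add: Ta)
qed

theorem corollary3:
  fixes T :: "'a::{archimedean_riesz_space, semiprime_f_algebra} \<Rightarrow>
    'b::{rel_uniform_complete_riesz_space, archimedean_riesz_space, semiprime_f_algebra}"
  assumes "algebra_homomorphism T" and "order_bounded T"
  shows "lattice_homomorphism T"
proof (rule positive_disjointness_preserving_lattice_homomorphism)
  show "linear T"
    using assms by (simp add: algebra_homomorphism_def)
  show "disjointness_preserving T"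
    using assms(1) by (rule algebra_homomorphism_disjointness_preserving)
  show "0 \<le> T x" if "0 \<le> x" for x
    using assms that by (rule order_bounded_algebra_homomorphism_nonneg)
qed

end
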